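(* Let $X$ be a finite connected poset, let $K$ be a field of characteristic zero, and fix $u_0\in X$. Then each $\frac12$-derivation $\varphi$ of the Lie algebra $(I(X,K),[\cdot,\cdot])$ is of the form $$\varphi=\mathrm{ad}_c+\varphi_\sigma+\varphi_\kappa$$ for a unique $c\in Z([I(X,K),I(X,K)])$, a unique map $\sigma:X^2_<\to K$ which is constant on chains and cycles in $X$, and a unique map $\kappa:X\to K$.
   Context: Incidence algebra. For a finite poset $X$, $I(X,K)$ is the associative $K$-algebra with basis $\{e_{xy}\mid x\le y\}$ and product $e_{xy}e_{uv}=e_{xv}$ if $y=u$, and $0$ otherwise. Write $f=\sum_{x\le y}f(x,y)e_{xy}$, $e_x:=e_{xx}$, and $\delta:=\sum_{x\in X}e_x$ (the identity). $I(X,K)$ is a Lie algebra under $[f,g]=fg-gf$. $Z(\cdot)$ denotes the center of a Lie algebra, and $[I(X,K),I(X,K)]=\langle e_{xy}\mid x<y\rangle$ is the derived algebra. $D(X,K)$ is the subspace spanned by $\{e_x\mid x\in X\}$. $X^2_<=\{(x,y)\in X^2\mid x<y\}$. $\frac12$-derivations. A $\frac12$-derivation of a Lie algebra $L$ over $K$ is a $K$-linear map $\varphi:L\to L$ with $\varphi([a,b])=\frac12([\varphi(a),b]+[a,\varphi(b)])$ for all $a,b\in L$. Walks and cycles. A chain is a totally ordered subset; the length of a poset is the maximum of $|C|-1$ over chains $C$ in it; for $x\le y$, $l(x,y)$ is the length of $\{z\mid x\le z\le y\}$. A walk from $x$ to $y$ is a sequence $x=x_0,x_1,\dots,x_m=y$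 in $X$ such that for each $0\le i\le m-1$ the elements $x_i,x_{i+1}$ are comparable with $l(x_i,x_{i+1})=1$ (if $x_i\le x_{i+1}$) or $l(x_{i+1},x_i)=1$ (if $x_{i+1}\le x_i$). It is closed if $x_0=x_m$. A path is a walk with $x_i\neq x_j$ for $i\ne j$. A cycle is a closed walk $x_0,\dots,x_m=x_0$ with $m\ge4$ such that for $i\neq j$, $x_i=x_j$ implies $\{i,j\}=\{0,m\}$. $X$ is connected if any two elements are joined by a path. Maps constant on chains and cycles. $\sigma:X^2_<\to K$ is constant on chains if $\sigma(x,y)=\sigma(u,v)$ whenever $x<y$ and $u<v$ belong to a same chain in $X$. It is constant on cycles if for every cycle $u_0,\dots,u_m=u_0$ there is $k\in K$ such that for all $0\le i\le m-1$: $\sigma(u_i,u_{i+1})=k$ if $u_i<u_{i+1}$, and $\sigma(u_{i+1},u_i)=k$ if $u_i>u_{i+1}$. The three types of $\frac12$-derivations. For $c\in Z([I(X,K),I(X,K)])$, $\mathrm{ad}_c(a)=[c,a]$. For $\sigma$ constant on chains and cycles, $\varphi_\sigma$ is the unique $\frac12$-derivation of $I(X,K)$ (it exists and is unique) such that $\varphi_\sigma(D(X,K))\subseteq D(X,K)$, $\varphi_\sigma(e_{xy})=\sigma(x,y)e_{xy}$ for all $x<y$, and $\varphi_\sigma(e_x)(u_0,u_0)=0$ for all $x\in X$. For $\kappa:X\to K$, $\varphi_\kappa$ is the linear map with $\varphi_\kappa(e_x)=\kappa(x)\delta$ for $x\in X$ and $\varphi_\kappa(e_{xy})=0$ for $x<y$.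 *)

theory Defs
  imports Complex_Main "HOL-Library.FuncSet"
begin

section \<open>Lie algebras and half-derivations\<close>

locale lie_algebra = vector_space scale
  for scale :: "'k::field \<Rightarrow> 'a::ab_group_add \<Rightarrow> 'a" +
  fixes bracket :: "'a \<Rightarrow> 'a \<Rightarrow> 'a"
  assumes bracket_add_left: "bracket (a + b) c = bracket a c + bracket b c"
    and bracket_add_right: "bracket a (b + c) = bracket a b + bracket a c"
    and bracket_scale_left: "bracket (scale r a) b = scale r (bracket a b)"
    and bracket_scale_right: "bracket a (scale r b) = scale r (bracket a b)"
    and bracket_self: "bracket a a = 0"
    and jacobi: "bracket a (bracket b c) + bracket b (bracket c a) + bracket c (bracket a b) = 0"
begin

definition derived :: "'a set" where
  "derived = span {bracket a b | a b. True}"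

text \<open>The center of a Lie subalgebra, which is given by its carrier.\<close>
definition center_of :: "'a set \<Rightarrow> 'a set" where
  "center_of S = {c \<in> S. \<forall>a\<in>S. bracket c a = 0}"

definition ad :: "'a \<Rightarrow> 'a \<Rightarrow> 'a" where
  "ad c a = bracket c a"

text \<open>Only meaningful if the characteristic is not 2, since otherwise \<open>1 / 2 = 0\<close>.\<close>
definition half_derivation :: "('a \<Rightarrow> 'a) \<Rightarrow> bool" where
  "half_derivation \<phi> \<longleftrightarrow> Vector_Spaces.linear scale scale \<phi> \<and>
    (\<forall>a b. \<phi> (bracket a b) = scale (1 / 2) (bracket (\<phi> a) b + bracket a (\<phi> b)))"

end


section \<open>The incidence algebra of a finite poset\<close>

text \<open>
  The poset is the universe of a type of class \<open>{finite, order}\<close>. An element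
  \<open>f = (\<Sum>x\<le>y. f(x,y) e\<^sub>x\<^sub>y)\<close> is represented by its coefficients, extended by zero to pairs
  with \<open>\<not> x \<le> y\<close>.
\<close>
typedef (overloaded) ('x::"{finite,order}", 'k::field) inc =
  "{f :: 'x \<Rightarrow> 'x \<Rightarrow> 'k. \<forall>x y. \<not> x \<le> y \<longrightarrow> f x y = 0}"
  morphisms coef Abs_inc
  by (rule exI[of _ "\<lambda>_ _. 0"]) simp

setup_lifting type_definition_inc

lemma coef_eq_0: "\<not> x \<le> y \<Longrightarrow> coef f x y = 0"
  by transfer simp

lemma inc_eqI: "(\<And>x y. coef f x y = coef g x y) \<Longrightarrow> f = g"
  by transfer (simp add: fun_eq_iff)

instantiation inc :: ("{finite,order}", field) ring_1
begin

lift_definition zero_inc :: "('a, 'b) inc" is "\<lambda>_ _. 0" by simp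
lift_definition one_inc :: "('a, 'b) inc" is "\<lambda>x y. if x = y then 1 else 0" by simp
lift_definition plus_inc :: "('a, 'b) inc \<Rightarrow> ('a, 'b) inc \<Rightarrow> ('a, 'b) inc"
  is "\<lambda>f g x y. f x y + g x y" by simp
lift_definition minus_inc :: "('a, 'b) inc \<Rightarrow> ('a, 'b) inc \<Rightarrow> ('a, 'b) inc"
  is "\<lambda>f g x y. f x y - g x y" by simp
lift_definition uminus_inc :: "('a, 'b) inc \<Rightarrow> ('a, 'b) inc"
  is "\<lambda>f x y. - f x y" by simp

text \<open>Only the \<open>z\<close> with \<open>x \<le> z \<le> y\<close> contribute to the sum.\<close>
lift_definition times_inc :: "('a, 'b) inc \<Rightarrow> ('a, 'b) inc \<Rightarrow> ('a, 'b) inc"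
  is "\<lambda>f g x y. \<Sum>z\<in>UNIV. f x z * g z y"
  by (intro allI impI sum.neutral ballI) (metis mult_eq_0_iff order_trans)

instance
proof
  fix a b c :: "('a, 'b) inc"
  show "a * b * c = a * (b * c)"
  proof (rule inc_eqI)
    fix x y
    have "coef (a * b * c) x y = (\<Sum>z\<in>UNIV. \<Sum>w\<in>UNIV. coef a x w * coef b w z * coef c z y)"
      by transfer (simp add: sum_distrib_right)
    also have "\<dots> = (\<Sum>w\<in>UNIV. \<Sum>z\<in>UNIV. coef a x w * coef b w z * coef c z y)"
      by (rule sum.swap)
    also have "\<dots> = coef (a * (b * c)) x y"
      by transfer (simp add: sum_distrib_left mult.assoc)
    finally show "coef (a * b * c) x y = coef (a * (b * c)) x y" .
  qed
  show "1 * a = a" by transfer (auto simp: fun_eq_iff if_distrib[of "\<lambda>u. u * _"] cong: if_cong)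
  show "a * 1 = a" by transfer (auto simp: fun_eq_iff if_distrib cong: if_cong)
  show "(a + b) * c = a * c + b * c"
    by transfer (simp add: fun_eq_iff distrib_right sum.distrib)
  show "a * (b + c) = a * b + a * c"
    by transfer (simp add: fun_eq_iff distrib_left sum.distrib)
  show "a + b + c = a + (b + c)" by transfer (simp add: fun_eq_iff)
  show "a + b = b + a" by transfer (simp add: fun_eq_iff)
  show "0 + a = a" by transfer (simp add: fun_eq_iff)
  show "- a + a = 0" by transfer (simp add: fun_eq_iff)
  show "a - b = a + - b" by transfer (simp add: fun_eq_iff)
  show "(0 :: ('a, 'b) inc) \<noteq> 1" by transfer (auto simp: fun_eq_iff)
qed

end

lift_definition inc_scale :: "'k::field \<Rightarrow> ('x::{finite,order}, 'k) inc \<Rightarrow> ('x, 'k) inc"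
  is "\<lambda>r f x y. r * f x y" by simp

text \<open>\<open>e x y\<close> is the basis element for \<open>x \<le> y\<close>, and 0 otherwise.\<close>
lift_definition e :: "'x::{finite,order} \<Rightarrow> 'x \<Rightarrow> ('x, 'k::field) inc"
  is "\<lambda>x y u v. if u = x \<and> v = y \<and> x \<le> y then 1 else 0" by auto

definition inc_bracket :: "('x::{finite,order}, 'k::field) inc \<Rightarrow> ('x, 'k) inc \<Rightarrow> ('x, 'k) inc" where
  "inc_bracket f g = f * g - g * f"

lemma coef_add [simp]: "coef (f + g) x y = coef f x y + coef g x y"
  by transfer simp

lemma coef_zero [simp]: "coef 0 x y = 0"
  by transfer simp

lemma coef_scale [simp]: "coef (inc_scale r f) x y = r * coef f x y"
  by transfer simp

lemma coef_one: "coef 1 x y = (if x = y then 1 else 0)"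
  by transfer simp

lemma coef_e: "coef (e x y) u v = (if u = x \<and> v = y \<and> x \<le> y then 1 else 0)"
  by transfer simp

lemma coef_sum [simp]: "coef (sum f A) x y = (\<Sum>i\<in>A. coef (f i) x y)"
  by (induction A rule: infinite_finite_induct) auto

lemma coef_mult: "coef (f * g) x y = (\<Sum>z\<in>UNIV. coef f x z * coef g z y)"
  by transfer simp

lemma e_mult:
  assumes "x \<le> y" "u \<le> v"
  shows "(e x y :: ('x::{finite,order}, 'k::field) inc) * e u v = (if y = u then e x v else 0)"
proof (rule inc_eqI)
  fix p q
  have "coef ((e x y :: ('x, 'k) inc) * e u v) p q =
      (\<Sum>z\<in>UNIV. if z = y then (if p = x \<and> y = u \<and> q = v then 1 else 0) else 0)"
    unfolding coef_mult coef_e using assms by (intro sum.cong) auto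
  also have "\<dots> = coef (if y = u then e x v else 0 :: ('x, 'k) inc) p q"
    using assms by (auto simp: coef_e)
  finally show "coef ((e x y :: ('x, 'k) inc) * e u v) p q =
      coef (if y = u then e x v else 0 :: ('x, 'k) inc) p q" .
qed

lemma inc_expand: "f = (\<Sum>x\<in>UNIV. \<Sum>y\<in>UNIV. inc_scale (coef f x y) (e x y))"
proof (rule inc_eqI)
  fix p q
  have "(\<Sum>x\<in>UNIV. \<Sum>y\<in>UNIV. coef f x y * coef (e x y) p q) =
      (\<Sum>x\<in>UNIV. \<Sum>y\<in>UNIV. if y = q then (if x = p then coef f p q else 0) else 0)"
    using coef_eq_0[of p q f] by (intro sum.cong refl) (auto simp: coef_e)
  then show "coef f p q = coef (\<Sum>x\<in>UNIV. \<Sum>y\<in>UNIV. inc_scale (coef f x y) (e x y)) p q"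
    by simp
qed

lemma one_eq_sum_e: "(1 :: ('x::{finite,order}, 'k::field) inc) = (\<Sum>x\<in>UNIV. e x x)"
proof (rule inc_eqI)
  fix p q
  have "(\<Sum>x\<in>UNIV. coef (e x x :: ('x, 'k) inc) p q) =
      (\<Sum>x\<in>UNIV. if x = p then (if p = q then 1 else 0) else 0)"
    by (intro sum.cong) (auto simp: coef_e)
  then show "coef (1 :: ('x, 'k) inc) p q = coef (\<Sum>x\<in>UNIV. e x x) p q"
    by (simp add: coef_one)
qed

lemma inc_scale_mult_left: "inc_scale r f * g = inc_scale r (f * g)"
  by (rule inc_eqI) (simp add: coef_mult sum_distrib_left mult.assoc)

lemma inc_scale_mult_right: "f * inc_scale r g = inc_scale r (f * g)"
  by (rule inc_eqI) (simp add: coef_mult sum_distrib_left mult.left_commute)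

lemma inc_scale_diff: "inc_scale r (f - g) = inc_scale r f - inc_scale r g"
  by transfer (simp add: fun_eq_iff right_diff_distrib)

global_interpretation inc: lie_algebra
  "inc_scale :: 'k::field \<Rightarrow> ('x::{finite,order}, 'k) inc \<Rightarrow> ('x, 'k) inc" inc_bracket
  by unfold_locales
    (auto simp: inc_bracket_def inc_scale_mult_left inc_scale_mult_right inc_scale_diff
      algebra_simps intro: inc_eqI)

definition diag :: "('x::{finite,order}, 'k::field) inc set" where
  "diag = inc.span (range (\<lambda>x. e x x))"

abbreviation strict_pairs :: "('x::order \<times> 'x) set" where
  "strict_pairs \<equiv> {(x, y). x < y}"


section \<open>Chains, walks and cycles\<close>

definition poset_length :: "'x::{finite,order} set \<Rightarrow> nat" where
  "poset_length S =
    Max ((\<lambda>C. card C - 1) ` {C. C \<subseteq> S \<and> C \<noteq> {} \<and> Complete_Partial_Order.chain (\<le>) C})"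

definition adjacent :: "'x::{finite,order} \<Rightarrow> 'x \<Rightarrow> bool" where
  "adjacent x y \<longleftrightarrow>
    (x \<le> y \<and> poset_length {x..y} = 1) \<or> (y \<le> x \<and> poset_length {y..x} = 1)"

text \<open>A walk \<open>x\<^sub>0, \<dots>, x\<^sub>m\<close> is a list of length \<open>m + 1\<close>.\<close>
definition walk :: "'x::{finite,order} list \<Rightarrow> bool" where
  "walk xs \<longleftrightarrow> xs \<noteq> [] \<and> (\<forall>i. Suc i < length xs \<longrightarrow> adjacent (xs ! i) (xs ! Suc i))"

definition path :: "'x::{finite,order} list \<Rightarrow> bool" where
  "path xs \<longleftrightarrow> walk xs \<and> distinct xs"

definition cycle :: "'x::{finite,order} list \<Rightarrow> bool" where
  "cycle xs \<longleftrightarrow> walk xs \<and> hd xs = last xs \<and> length xs - 1 \<ge> 4 \<and>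
    (\<forall>i < length xs. \<forall>j < length xs.
      i \<noteq> j \<and> xs ! i = xs ! j \<longrightarrow> {i, j} = {0, length xs - 1})"

definition connected_poset :: "'x::{finite,order} itself \<Rightarrow> bool" where
  "connected_poset _ \<longleftrightarrow> (\<forall>x y :: 'x. \<exists>xs. path xs \<and> hd xs = x \<and> last xs = y)"

definition const_on_chains :: "('x::{finite,order} \<times> 'x \<Rightarrow> 'k) \<Rightarrow> bool" where
  "const_on_chains \<sigma> \<longleftrightarrow>
    (\<forall>C. Complete_Partial_Order.chain (\<le>) C \<longrightarrow>
      (\<forall>x\<in>C. \<forall>y\<in>C. \<forall>u\<in>C. \<forall>v\<in>C. x < y \<and> u < v \<longrightarrow> \<sigma> (x, y) = \<sigma> (u, v)))"

definition const_on_cycles :: "('x::{finite,order} \<times> 'x \<Rightarrow> 'k) \<Rightarrow> bool" where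
  "const_on_cycles \<sigma> \<longleftrightarrow>
    (\<forall>us. cycle us \<longrightarrow>
      (\<exists>k. \<forall>i. Suc i < length us \<longrightarrow>
        (us ! i < us ! Suc i \<longrightarrow> \<sigma> (us ! i, us ! Suc i) = k) \<and>
        (us ! i > us ! Suc i \<longrightarrow> \<sigma> (us ! Suc i, us ! i) = k)))"


section \<open>The half-derivations attached to \<open>\<sigma>\<close> and \<open>\<kappa>\<close>\<close>

text \<open>The value is meaningful only if \<open>\<sigma>\<close> is constant on chains and cycles.\<close>
definition phi_sigma ::
  "'x::{finite,order} \<Rightarrow> ('x \<times> 'x \<Rightarrow> 'k::field) \<Rightarrow> ('x, 'k) inc \<Rightarrow> ('x, 'k) inc" where
  "phi_sigma u0 \<sigma> = (THE \<phi>. inc.half_derivation \<phi> \<and> \<phi> ` diag \<subseteq> diag \<and>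
    (\<forall>x y. x < y \<longrightarrow> \<phi> (e x y) = inc_scale (\<sigma> (x, y)) (e x y)) \<and>
    (\<forall>x. coef (\<phi> (e x x)) u0 u0 = 0))"

definition phi_kappa ::
  "('x::{finite,order} \<Rightarrow> 'k::field) \<Rightarrow> ('x, 'k) inc \<Rightarrow> ('x, 'k) inc" where
  "phi_kappa \<kappa> f = inc_scale (\<Sum>x\<in>UNIV. coef f x x * \<kappa> x) 1"

lemma phi_kappa_unique:
  "\<psi> = phi_kappa \<kappa> \<longleftrightarrow>
    Vector_Spaces.linear inc_scale inc_scale \<psi> \<and>
    (\<forall>x. \<psi> (e x x) = inc_scale (\<kappa> x) 1) \<and> (\<forall>x y. x < y \<longrightarrow> \<psi> (e x y) = 0)"
  (is "_ \<longleftrightarrow> ?P \<psi>")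
proof -
  have add: "phi_kappa \<kappa> (f + g) = phi_kappa \<kappa> f + phi_kappa \<kappa> g" for f g
    by (rule inc_eqI) (simp add: phi_kappa_def sum.distrib algebra_simps)
  have scale: "phi_kappa \<kappa> (inc_scale r f) = inc_scale r (phi_kappa \<kappa> f)" for r f
    by (rule inc_eqI) (simp add: phi_kappa_def sum_distrib_left mult.assoc)
  have lin: "Vector_Spaces.linear inc_scale inc_scale (phi_kappa \<kappa>)"
    by unfold_locales (simp_all add: add scale)
  have diag: "phi_kappa \<kappa> (e x x) = inc_scale (\<kappa> x) 1" for x
  proof -
    have "(\<Sum>z\<in>UNIV. coef (e x x) z z * \<kappa> z) = (\<Sum>z\<in>UNIV. if z = x then \<kappa> x else 0)"
      by (intro sum.cong) (auto simp: coef_e)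
    then show ?thesis by (simp add: phi_kappa_def)
  qed
  have off: "phi_kappa \<kappa> (e x y) = 0" if "x < y" for x y
  proof -
    have "(\<Sum>z\<in>UNIV. coef (e x y) z z * \<kappa> z) = 0"
      using that by (intro sum.neutral) (auto simp: coef_e)
    then show ?thesis by (simp add: phi_kappa_def)
  qed
  have "\<psi> = phi_kappa \<kappa>" if P: "?P \<psi>"
  proof
    fix f
    interpret psi: Vector_Spaces.linear inc_scale inc_scale \<psi> using P by blast
    interpret phi: Vector_Spaces.linear inc_scale inc_scale "phi_kappa \<kappa>" by (rule lin)
    have basis: "\<psi> (e x y) = phi_kappa \<kappa> (e x y)" for x y
    proof (cases "x \<le> y")
      case True
      then show ?thesis using P diag off by (cases "x = y") auto
    next
      case False
      then have "(e x y :: ('a, 'b) inc) = 0" by (intro inc_eqI) (auto simp: coef_e)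
      then show ?thesis by (simp add: psi.zero phi.zero)
    qed
    show "\<psi> f = phi_kappa \<kappa> f"
      by (subst (1 2) inc_expand)
        (simp add: psi.sum phi.sum psi.scale phi.scale basis del: coef_sum)
  qed
  then show ?thesis using lin diag off by blast
qed

end

theory Submission
  imports Defs
begin

text \<open>
  Testing a half-derivation \<open>\<phi>\<close> on \<open>[e x x, e y y] = 0\<close> and \<open>[e x x, e x y] = e x y = [e x y, e y y]\<close>
  shows that the off-diagonal parts of the \<open>\<phi> (e x x)\<close> come from a central \<open>c\<close> and that
  \<open>\<phi> (e x y) = \<sigma>(x, y) e x y\<close>. The diagonal \<open>D x\<close> of \<open>\<phi> (e x x)\<close> is constant along the relations
  avoiding \<open>x\<close> and drops by \<open>\<sigma>\<close> from \<open>x\<close> to a comparable element. Such a family \<open>D\<close> forces \<open>\<sigma>\<close> to be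
  constant on chains and cycles: two neighbours of \<open>x\<close> joined by a walk avoiding \<open>x\<close> see the same
  value. Conversely, if \<open>\<sigma>\<close> is constant on chains and cycles, \<open>D x u\<close> can be read off from \<open>\<sigma>\<close> on the
  first edge of any path from \<open>x\<close> to \<open>u\<close>, and \<open>D\<close> yields \<open>\<phi>\<^sub>\<sigma>\<close>. By connectedness \<open>D\<close> is unique up to an
  additive constant for each \<open>x\<close>, which the value at \<open>u0\<close>, that is \<open>\<kappa>\<close>, fixes.
\<close>

section \<open>The Hasse diagram\<close>

text \<open>Identifies \<open>adjacent\<close> with the edges of the Hasse diagram. An intermediate
  \<open>z\<close> yields the three-element chain \<open>{x, z, y}\<close>; without one the interval
  is just \<open>{x, y}\<close>.\<close>

lemma poset_length_eq_1_iff: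
  fixes x y :: "'x::{finite,order}"
  assumes "x \<le> y"
  shows "poset_length {x..y} = 1 \<longleftrightarrow> x < y \<and> \<not> (\<exists>z. x < z \<and> z < y)"
proof -
  define CC where "CC = {C. C \<subseteq> {x..y} \<and> C \<noteq> {} \<and> Complete_Partial_Order.chain (\<le>) C}"
  define N where "N = (\<lambda>C::'x set. card C - 1) ` CC"
  have len: "poset_length {x..y} = Max N"
    by (simp add: poset_length_def N_def CC_def)
  have fin: "finite N" by (simp add: N_def)
  have mem: "card C - 1 \<in> N" if "C \<subseteq> {x..y}" "C \<noteq> {}" "Complete_Partial_Order.chain (\<le>) C" for C
    using that by (auto simp: N_def CC_def)
  have "0 \<in> N"
    using mem[of "{x}"] assms by (auto simp: Complete_Partial_Order.chain_def)
  then have ne: "N \<noteq> {}" by auto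
  show ?thesis
  proof (intro iffI conjI notI)
    assume 1: "poset_length {x..y} = 1"
    show "x < y"
    proof (rule ccontr)
      assume "\<not> x < y"
      then have "y = x" using assms by (simp add: order.order_iff_strict)
      have C: "card C - 1 = 0" if "C \<in> CC" for C
      proof -
        have "C \<subseteq> {x}" using that unfolding CC_def \<open>y = x\<close> by simp
        then have "card C \<le> card {x}" by (intro card_mono) auto
        then show ?thesis by simp
      qed
      have "N \<subseteq> {0}" using C by (auto simp: N_def)
      then show False using Max_in[OF fin ne] 1 len by auto
    qed
    assume "\<exists>z. x < z \<and> z < y"
    then obtain z where z: "x < z" "z < y" by blast
    have "card {x, z, y} - 1 \<in> N"
      by (rule mem) (use z assms in \<open>auto simp: Complete_Partial_Order.chain_def\<close>)
    moreover have "card {x, z, y} = 3"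
    proof -
      have "x \<noteq> z" "z \<noteq> y" "x \<noteq> y" using z by auto
      then show ?thesis by simp
    qed
    ultimately have "2 \<le> Max N" using Max_ge[OF fin] by force
    then show False using 1 len by simp
  next
    assume *: "x < y \<and> \<not> (\<exists>z. x < z \<and> z < y)"
    then have I: "{x..y} = {x, y}" by (auto simp: order.order_iff_strict)
    have "1 \<in> N"
      using mem[of "{x, y}"] * by (auto simp: Complete_Partial_Order.chain_def)
    moreover have "n \<le> 1" if "n \<in> N" for n
    proof -
      obtain C where C: "C \<subseteq> {x, y}" "n = card C - 1" using \<open>n \<in> N\<close> I by (auto simp: N_def CC_def)
      have "card C \<le> card {x, y}" using C by (intro card_mono) auto
      also have "\<dots> \<le> 2" by (simp add: card_insert_if)
      finally show ?thesis using C by simp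
    qed
    ultimately have "Max N = 1" using fin by (intro Max_eqI) auto
    then show "poset_length {x..y} = 1" using len by simp
  qed
qed

lemma adjacent_iff:
  "adjacent x y \<longleftrightarrow> (x < y \<and> \<not> (\<exists>z. x < z \<and> z < y)) \<or> (y < x \<and> \<not> (\<exists>z. y < z \<and> z < x))"
  unfolding adjacent_def using poset_length_eq_1_iff[of x y] poset_length_eq_1_iff[of y x]
  by (auto simp: less_imp_le)

lemma adjacent_sym: "adjacent x y \<Longrightarrow> adjacent y x"
  by (auto simp: adjacent_def)

lemma adjacent_comparable: "adjacent x y \<Longrightarrow> x < y \<or> y < x"
  by (auto simp: adjacent_iff)

text \<open>Three pairwise comparable elements form a chain, and its extremes have the third element
  strictly between them.\<close>

lemma no_adjacent_triangle: "adjacent x y \<Longrightarrow> adjacent y z \<Longrightarrow> \<not> adjacent x z"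
  unfolding adjacent_iff by (meson less_asym less_trans)

lemma ex_upper_cover:
  fixes a b :: "'x::{finite,order}"
  assumes "a < b"
  obtains c where "adjacent a c" "a < c" "c \<le> b"
proof -
  obtain c where c: "c \<in> {z. a < z \<and> z \<le> b}"
    and min: "\<And>z. z \<in> {z. a < z \<and> z \<le> b} \<Longrightarrow> z \<le> c \<Longrightarrow> z = c"
    using finite_has_minimal[of "{z. a < z \<and> z \<le> b}"] assms by auto
  have "\<not> (\<exists>z. a < z \<and> z < c)"
  proof
    assume "\<exists>z. a < z \<and> z < c"
    then obtain z where "a < z" "z < c" by blast
    moreover from this have "z \<le> b" using c by auto
    ultimately show False using min[of z] by (auto dest: less_imp_le)
  qed
  then show ?thesis using that[of c] c by (auto simp: adjacent_iff)
qed

lemma ex_lower_cover: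
  fixes a b :: "'x::{finite,order}"
  assumes "a < b"
  obtains c where "adjacent b c" "c < b" "a \<le> c"
proof -
  obtain c where c: "c \<in> {z. a \<le> z \<and> z < b}"
    and max: "\<And>z. z \<in> {z. a \<le> z \<and> z < b} \<Longrightarrow> c \<le> z \<Longrightarrow> z = c"
    using finite_has_maximal[of "{z. a \<le> z \<and> z < b}"] assms by force
  have "\<not> (\<exists>z. c < z \<and> z < b)"
  proof
    assume "\<exists>z. c < z \<and> z < b"
    then obtain z where "c < z" "z < b" by blast
    moreover from this have "a \<le> z" using c by auto
    ultimately show False using max[of z] by (auto dest: less_imp_le)
  qed
  then show ?thesis using that[of c] c by (auto simp: adjacent_iff)
qed

section \<open>Reachability in the Hasse diagram with one vertex deleted\<close>

lemma walk_iff_successively: "walk xs \<longleftrightarrow> xs \<noteq> [] \<and> successively adjacent xs"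
  by (auto simp: walk_def successively_conv_nth)

text \<open>A relation rather than a set of lists, so that walks avoiding \<open>x\<close> become
  its reflexive transitive closure. The closure also contains \<open>(x, x)\<close>.\<close>

definition adj_avoiding :: "'x::{finite,order} \<Rightarrow> ('x \<times> 'x) set" where
  "adj_avoiding x = {(a, b). adjacent a b \<and> a \<noteq> x \<and> b \<noteq> x}"

lemma walk_imp_adj_avoiding_rtrancl:
  "successively adjacent (y # ys) \<Longrightarrow> x \<notin> set (y # ys) \<Longrightarrow> (y, last (y # ys)) \<in> (adj_avoiding x)\<^sup>*"
proof (induction ys arbitrary: y)
  case (Cons z zs)
  then have "(y, z) \<in> adj_avoiding x" "(z, last (z # zs)) \<in> (adj_avoiding x)\<^sup>*"
    by (auto simp: adj_avoiding_def)
  then show ?case by (simp add: converse_rtrancl_into_rtrancl)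
qed simp

text \<open>The path grows with the derivation; when the next vertex has already been visited, the
  path is cut back to that visit.\<close>

lemma adj_avoiding_rtrancl_imp_path:
  assumes "(y, z) \<in> (adj_avoiding x)\<^sup>*" "y \<noteq> x"
  shows "\<exists>xs. path xs \<and> hd xs = y \<and> last xs = z \<and> x \<notin> set xs"
  using assms(1)
proof induction
  case base
  show ?case using assms(2)
    by (intro exI[of _ "[y]"]) (auto simp: path_def walk_iff_successively)
next
  case (step b c)
  then obtain xs where xs: "path xs" "hd xs = y" "last xs = b" "x \<notin> set xs" by blast
  show ?case
  proof (cases "c \<in> set xs")
    case True
    then obtain as bs where *: "xs = as @ c # bs" by (meson split_list)
    show ?thesis using xs unfolding *
      by (intro exI[of _ "as @ [c]"])
        (auto simp: path_def walk_iff_successively successively_append_iff hd_append split: if_splits)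
  next
    case False
    show ?thesis using xs False step(2)
      by (intro exI[of _ "xs @ [c]"])
        (auto simp: path_def walk_iff_successively successively_append_iff adj_avoiding_def)
  qed
qed

text \<open>Climbing from \<open>a\<close> to \<open>b\<close> by covers never leaves the interval,
  hence never meets \<open>x\<close>.\<close>

lemma interval_adj_avoiding_rtrancl:
  fixes a b x :: "'x::{finite,order}"
  assumes "a \<le> b" "x \<notin> {a..b}"
  shows "(a, b) \<in> (adj_avoiding x)\<^sup>*"
  using assms
proof (induction "card {a..b}" arbitrary: a rule: less_induct)
  case less
  show ?case
  proof (cases "a = b")
    case False
    then have "a < b" using less.prems by simp
    then obtain c where c: "adjacent a c" "a < c" "c \<le> b" by (rule ex_upper_cover)
    have "{c..b} \<subset> {a..b}" using c less.prems by force
    then have "card {c..b} < card {a..b}" by (intro psubset_card_mono) auto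
    then have "(c, b) \<in> (adj_avoiding x)\<^sup>*"
      using less.hyps[of c] c less.prems by auto
    moreover have "(a, c) \<in> adj_avoiding x"
      using c less.prems by (auto simp: adj_avoiding_def)
    ultimately show ?thesis by (rule converse_rtrancl_into_rtrancl[rotated])
  qed simp
qed

lemma connected_poset_constant:
  fixes f :: "'x::{finite,order} \<Rightarrow> 'a"
  assumes "connected_poset TYPE('x)" and f: "\<And>u v. u < v \<Longrightarrow> f u = f v"
  shows "f u = f v"
proof -
  obtain xs where xs: "walk xs" "hd xs = u" "last xs = v"
    using assms(1) unfolding connected_poset_def path_def by blast
  have "f (hd ys) = f (last ys)" if "successively adjacent ys" "ys \<noteq> []" for ys
    using that
  proof (induction ys rule: induct_list012)
    case (3 a b zs)
    then have "a < b \<or> b < a" by (intro adjacent_comparable) simp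
    then have "f a = f b" using f by metis
    then show ?case using 3 by simp
  qed auto
  then show ?thesis using xs by (auto simp: walk_iff_successively)
qed


section \<open>Potentials\<close>

text \<open>\<open>D x u\<close> plays the role of the coefficient of \<open>\<phi> (e x x)\<close> at \<open>(u, u)\<close>.\<close>
definition potential :: "('x::order \<times> 'x \<Rightarrow> 'k::field) \<Rightarrow> ('x \<Rightarrow> 'x \<Rightarrow> 'k) \<Rightarrow> bool" where
  "potential \<sigma> D \<longleftrightarrow>
    (\<forall>x u v. u < v \<longrightarrow> D x u - D x v = (of_bool (u = x) - of_bool (v = x)) * \<sigma> (u, v))"

text \<open>Reads \<sigma> on an edge traversed in either direction, as walks require. On elements
  that are not strictly comparable the value has no meaning.\<close>

definition edge_val :: "('x::order \<times> 'x \<Rightarrow> 'k) \<Rightarrow> 'x \<Rightarrow> 'x \<Rightarrow> 'k" where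
  "edge_val \<sigma> x y = (if x < y then \<sigma> (x, y) else \<sigma> (y, x))"

lemma edge_val_less: "x < y \<Longrightarrow> edge_val \<sigma> x y = \<sigma> (x, y)"
  and edge_val_greater: "y < x \<Longrightarrow> edge_val \<sigma> x y = \<sigma> (y, x)"
  by (auto simp: edge_val_def)

lemma edge_val_sym: "x < y \<or> y < x \<Longrightarrow> edge_val \<sigma> x y = edge_val \<sigma> y x"
  by (auto simp: edge_val_def)

lemma potential_off:
  assumes "potential \<sigma> D" "u < v \<or> v < u" "u \<noteq> x" "v \<noteq> x"
  shows "D x u = D x v"
proof -
  have "D x a = D x b" if "a < b" "a \<noteq> x" "b \<noteq> x" for a b
    using assms(1)[unfolded potential_def, rule_format, OF that(1), of x] that by simp
  then show ?thesis using assms by metis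
qed

text \<open>Passing from \<open>x < u\<close> to \<open>u < x\<close> reverses both the difference
  and the sign of its coefficient, so the drop away from \<open>x\<close> does not depend on the
  direction.\<close>

lemma potential_at:
  assumes "potential \<sigma> D" "u < x \<or> x < u"
  shows "edge_val \<sigma> x u = D x x - D x u"
  using assms(2)
proof
  assume "u < x"
  then show ?thesis
    using assms(1)[unfolded potential_def, rule_format, OF \<open>u < x\<close>, of x]
    by (auto simp: edge_val_def algebra_simps)
next
  assume "x < u"
  then show ?thesis
    using assms(1)[unfolded potential_def, rule_format, OF \<open>x < u\<close>, of x]
    by (auto simp: edge_val_def)
qed

text \<open>Moving the upper end of a pair starting at \<open>x\<close> does not change \<sigma>,
  because \<open>D x\<close> is constant along relations avoiding \<open>x\<close>; dually for the
  lower end.\<close>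

lemma potential_imp_const_on_chains:
  assumes pot: "potential \<sigma> D"
  shows "const_on_chains \<sigma>"
proof -
  have lo: "\<sigma> (x, y) = \<sigma> (x, z)" if "x < y" "y \<le> z" for x y z
  proof (cases "y = z")
    case False
    then have "D x y = D x z" using that by (intro potential_off[OF pot]) auto
    then show ?thesis
      using potential_at[OF pot, of y x] potential_at[OF pot, of z x] that less_le_trans[OF that]
      by (simp add: edge_val_def)
  qed simp
  have hi: "\<sigma> (y, z) = \<sigma> (x, z)" if "x \<le> y" "y < z" for x y z
  proof (cases "x = y")
    case False
    then have "D z x = D z y" using that by (intro potential_off[OF pot]) auto
    then show ?thesis
      using potential_at[OF pot, of y z] potential_at[OF pot, of x z] that le_less_trans[OF that]
      by (auto simp: edge_val_greater)
  qed simp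
  show ?thesis
    unfolding const_on_chains_def
  proof (intro allI impI ballI)
    fix C and x y u v :: 'a
    assume C: "Complete_Partial_Order.chain (\<le>) C" "x \<in> C" "y \<in> C" "u \<in> C" "v \<in> C"
      and *: "x < y \<and> u < v"
    \<comment> \<open>Both pairs are stretched to \<open>(a, b)\<close>: first the upper end is
      moved to \<open>b\<close>, then the lower end to \<open>a\<close>.\<close>
    obtain a where a: "a \<le> x" "a \<le> u"
      using C by (metis Complete_Partial_Order.chain_def order_refl)
    obtain b where b: "y \<le> b" "v \<le> b"
      using C by (metis Complete_Partial_Order.chain_def order_refl)
    have "\<sigma> (x, y) = \<sigma> (a, b)" using lo[of x y b] hi[of a x b] * a b by auto
    moreover have "\<sigma> (u, v) = \<sigma> (a, b)" using lo[of u v b] hi[of a u b] * a b by auto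
    ultimately show "\<sigma> (x, y) = \<sigma> (u, v)" by simp
  qed
qed

text \<open>Consecutive edges meet in a vertex \<open>x\<close>, and their values are the drops of
  \<open>D x\<close> from \<open>x\<close> to its two neighbours on the cycle, which
  coincide.\<close>

lemma potential_imp_const_on_cycles:
  assumes pot: "potential \<sigma> D"
  shows "const_on_cycles \<sigma>"
  unfolding const_on_cycles_def
proof (intro allI impI)
  fix us :: "'a list"
  assume cyc: "cycle us"
  define m where "m = length us - 1"
  have m: "4 \<le> m" "length us = Suc m" using cyc by (auto simp: cycle_def m_def)
  have "us \<noteq> []" using m by auto
  then have closed: "us ! 0 = us ! m"
    using cyc by (simp add: cycle_def hd_conv_nth last_conv_nth m_def)
  have cmp: "us ! i < us ! Suc i \<or> us ! Suc i < us ! i" if "i < m" for i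
    using cyc that m by (auto simp: cycle_def walk_def dest!: spec[of _ i] adjacent_comparable)
  \<comment> \<open>An inner vertex of the list occurs once; only the two ends coincide.\<close>
  have inj: "us ! i \<noteq> us ! j" if "i \<noteq> j" "i \<le> m" "j \<le> m" "0 < i" "i < m" for i j
  proof
    assume "us ! i = us ! j"
    then have "{i, j} = {0, length us - 1}" using cyc that m unfolding cycle_def by auto
    then show False using that m by (auto simp: doubleton_eq_iff)
  qed
  text \<open>The two neighbours of \<open>us ! Suc i\<close> are linked by the rest of the cycle.\<close>
  have step: "edge_val \<sigma> (us ! i) (us ! Suc i) = edge_val \<sigma> (us ! Suc i) (us ! Suc (Suc i))"
    if i: "Suc i < m" for i
  proof -
    define x where "x = us ! Suc i"
    have nx: "us ! j \<noteq> x" if "j \<le> m" "j \<noteq> Suc i" for j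
      using inj[of "Suc i" j] that i by (auto simp: x_def)
    \<comment> \<open>The rest of the cycle consists of the segments before and after
      \<open>x\<close>, glued at \<open>us ! 0 = us ! m\<close>.\<close>
    have low: "D x (us ! j) = D x (us ! 0)" if "j \<le> i" for j
      using that
    proof (induction j)
      case (Suc j)
      then have "D x (us ! j) = D x (us ! Suc j)"
        using cmp[of j] nx[of j] nx[of "Suc j"] i by (intro potential_off[OF pot]) auto
      then show ?case using Suc by simp
    qed simp
    have high: "D x (us ! Suc (Suc i)) = D x (us ! j)" if "Suc (Suc i) \<le> j" "j \<le> m" for j
      using that
    proof (induction j rule: dec_induct)
      case (step j)
      then have "D x (us ! j) = D x (us ! Suc j)"
        using cmp[of j] nx[of j] nx[of "Suc j"] by (intro potential_off[OF pot]) auto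
      then show ?case using step by simp
    qed simp
    have "D x (us ! i) = D x (us ! Suc (Suc i))"
      using low[of i] high[of m] closed i by simp
    then show ?thesis
      using potential_at[OF pot, of "us ! i" x] potential_at[OF pot, of "us ! Suc (Suc i)" x]
        cmp[of i] cmp[of "Suc i"] i edge_val_sym[of "us ! i" x \<sigma>]
      by (auto simp: x_def)
  qed
  have const: "edge_val \<sigma> (us ! i) (us ! Suc i) = edge_val \<sigma> (us ! 0) (us ! Suc 0)" if "i < m" for i
    using that by (induction i) (auto simp: step)
  show "\<exists>k. \<forall>i. Suc i < length us \<longrightarrow>
      (us ! i < us ! Suc i \<longrightarrow> \<sigma> (us ! i, us ! Suc i) = k) \<and>
      (us ! i > us ! Suc i \<longrightarrow> \<sigma> (us ! Suc i, us ! i) = k)"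
  proof (intro exI allI impI)
    fix i
    assume "Suc i < length us"
    then have "edge_val \<sigma> (us ! i) (us ! Suc i) = edge_val \<sigma> (us ! 0) (us ! Suc 0)"
      using m by (intro const) simp
    then show "(us ! i < us ! Suc i \<longrightarrow> \<sigma> (us ! i, us ! Suc i) = edge_val \<sigma> (us ! 0) (us ! Suc 0)) \<and>
      (us ! i > us ! Suc i \<longrightarrow> \<sigma> (us ! Suc i, us ! i) = edge_val \<sigma> (us ! 0) (us ! Suc 0))"
      by (auto simp: edge_val_less edge_val_greater)
  qed
qed

section \<open>Potentials from maps constant on chains and cycles\<close>

lemma const_on_chains_triple:
  assumes "const_on_chains \<sigma>" "x < y" "y < z"
  shows "\<sigma> (x, y) = \<sigma> (x, z)" "\<sigma> (y, z) = \<sigma> (x, z)"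
proof -
  have "Complete_Partial_Order.chain (\<le>) {x, y, z}"
    using assms by (auto simp: Complete_Partial_Order.chain_def)
  note * = assms(1)[unfolded const_on_chains_def, rule_format, OF this]
  show "\<sigma> (x, y) = \<sigma> (x, z)" "\<sigma> (y, z) = \<sigma> (x, z)"
    by (rule *; use assms in auto)+
qed

lemma const_on_chains_le:
  assumes "const_on_chains \<sigma>"
  shows "x < y \<Longrightarrow> y \<le> z \<Longrightarrow> \<sigma> (x, y) = \<sigma> (x, z)"
    and "x \<le> y \<Longrightarrow> y < z \<Longrightarrow> \<sigma> (y, z) = \<sigma> (x, z)"
  using const_on_chains_triple[OF assms, of x y z] by (auto simp: order.order_iff_strict)

text \<open>A path from \<open>y\<close> to \<open>z\<close> avoiding \<open>x\<close> closes up
  through \<open>x\<close> to a cycle, whose first and last edges are the two in question.\<close>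

lemma const_on_cycles_neighbours:
  fixes x y z :: "'x::{finite,order}"
  assumes "const_on_cycles \<sigma>" "adjacent x y" "adjacent x z" "(y, z) \<in> (adj_avoiding x)\<^sup>*"
  shows "edge_val \<sigma> x y = edge_val \<sigma> x z"
proof (cases "y = z")
  case False
  have "y \<noteq> x" using assms(2) adjacent_comparable by blast
  then obtain xs where xs: "path xs" "hd xs = y" "last xs = z" "x \<notin> set xs"
    using adj_avoiding_rtrancl_imp_path[OF assms(4)] by blast
  have ne: "xs \<noteq> []" and succ: "successively adjacent xs" and dist: "distinct xs"
    using xs by (auto simp: path_def walk_iff_successively)
  \<comment> \<open>The closed walk has \<open>length xs + 1\<close> edges and a cycle needs four. A
    two-vertex path would make \<open>x\<close>, \<open>y\<close>, \<open>z\<close> a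
    triangle.\<close>
  have len: "length xs \<ge> 3"
  proof (rule ccontr)
    assume "\<not> length xs \<ge> 3"
    moreover have "0 < length xs" using ne by simp
    ultimately have "length xs = 1 \<or> length xs = 2" by linarith
    then show False
    proof
      assume "length xs = 1"
      then show False using xs False by (cases xs) auto
    next
      assume "length xs = 2"
      then have "xs = [y, z]" using xs by (auto simp: length_Suc_conv numeral_2_eq_2)
      then have "adjacent y z" using succ by simp
      then show False using no_adjacent_triangle assms by blast
    qed
  qed
  let ?us = "x # xs @ [x]"
  have cyc: "cycle ?us"
    unfolding cycle_def walk_iff_successively
  proof (intro conjI allI impI)
    show "successively adjacent ?us"
      using succ assms(2,3) xs ne adjacent_sym
      by (auto simp: successively_Cons successively_append_iff)
    show "length ?us - 1 \<ge> 4" using len by simp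
    fix i j
    assume ij: "i < length ?us" "j < length ?us" and eq: "i \<noteq> j \<and> ?us ! i = ?us ! j"
    \<comment> \<open>Dropping either end of the closed list leaves distinct entries, so a
      repetition must involve both ends.\<close>
    have d: "distinct (x # xs)" "distinct (xs @ [x])" using dist xs by auto
    have "\<not> (i \<le> length xs \<and> j \<le> length xs)"
    proof
      assume "i \<le> length xs \<and> j \<le> length xs"
      then have "?us ! i = (x # xs) ! i" "?us ! j = (x # xs) ! j"
        by (auto simp: nth_Cons nth_append split: nat.split)
      then show False using eq nth_eq_iff_index_eq[OF d(1)] \<open>i \<le> length xs \<and> j \<le> length xs\<close> by auto
    qed
    moreover have "\<not> (0 < i \<and> 0 < j)"
    proof
      assume "0 < i \<and> 0 < j"
      then have "?us ! i = (xs @ [x]) ! (i - 1)" "?us ! j = (xs @ [x]) ! (j - 1)"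
        by (auto simp: nth_Cons split: nat.split)
      then show False using eq nth_eq_iff_index_eq[OF d(2)] \<open>0 < i \<and> 0 < j\<close> ij by auto
    qed
    ultimately show "{i, j} = {0, length ?us - 1}" using ij by auto
  qed auto
  obtain k where k: "\<And>i. Suc i < length ?us \<Longrightarrow>
        (?us ! i < ?us ! Suc i \<longrightarrow> \<sigma> (?us ! i, ?us ! Suc i) = k) \<and>
        (?us ! i > ?us ! Suc i \<longrightarrow> \<sigma> (?us ! Suc i, ?us ! i) = k)"
    using assms(1) cyc unfolding const_on_cycles_def by blast
  have "?us ! 0 = x" "?us ! Suc 0 = y" "?us ! length xs = z" "?us ! Suc (length xs) = x"
    using xs ne by (auto simp: hd_conv_nth last_conv_nth nth_append nth_Cons')
  then show ?thesis
    using k[of 0] k[of "length xs"] adjacent_comparable[OF assms(2)] adjacent_comparable[OF assms(3)]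
    by (auto simp: edge_val_def)
qed simp

text \<open>\<open>E x\<close> is built with value 0 at \<open>x\<close> and minus the value of the
  first edge towards \<open>u\<close> elsewhere; cycles make it well defined, chains give the
  correct drops at non-covering relations.\<close>

lemma ex_potential:
  fixes u0 :: "'x::{finite,order}" and \<sigma> :: "'x \<times> 'x \<Rightarrow> 'k::field"
  assumes conn: "connected_poset TYPE('x)"
    and chains: "const_on_chains \<sigma>" and cycles: "const_on_cycles \<sigma>"
  obtains D where "potential \<sigma> D" "\<And>x. D x u0 = 0"
proof -
  \<comment> \<open>\<open>y\<close> is the first vertex after \<open>x\<close> on some walk to
    \<open>u\<close> that does not return to \<open>x\<close>.\<close>
  define nb where "nb x u y \<longleftrightarrow> adjacent x y \<and> (y, u) \<in> (adj_avoiding x)\<^sup>*" for x u y :: 'x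
  define E where "E x u = (if u = x then 0 else - edge_val \<sigma> x (SOME y. nb x u y))" for x u
  have sym: "sym ((adj_avoiding x)\<^sup>*)" for x :: 'x
    by (intro sym_rtrancl) (auto simp: adj_avoiding_def sym_def intro: adjacent_sym)
  have E: "E x u = - edge_val \<sigma> x y" if "nb x u y" "u \<noteq> x" for x u y
  proof -
    have "nb x u (SOME y. nb x u y)" using that(1) by (rule someI)
    then have "edge_val \<sigma> x (SOME y. nb x u y) = edge_val \<sigma> x y"
      using that(1) sym unfolding nb_def
      by (intro const_on_cycles_neighbours[OF cycles]) (auto dest: symD intro: rtrancl_trans)
    then show ?thesis using that by (simp add: E_def)
  qed
  \<comment> \<open>The second vertex of a path from \<open>x\<close> to \<open>u\<close> serves: by
    distinctness the remaining path avoids \<open>x\<close>.\<close>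
  have ex: "\<exists>y. nb x u y" if ne: "u \<noteq> x" for x u
  proof -
    obtain xs where xs: "path xs" "hd xs = x" "last xs = u"
      using conn unfolding connected_poset_def by blast
    then obtain y ys where "xs = x # y # ys"
      using ne by (cases xs; cases "tl xs") (auto simp: path_def walk_def)
    then show ?thesis
      using xs walk_imp_adj_avoiding_rtrancl[of y ys x]
      by (auto simp: nb_def path_def walk_iff_successively)
  qed
  have up: "E a b = - \<sigma> (a, b)" if ab: "a < b" for a b
  proof -
    obtain c where c: "adjacent a c" "a < c" "c \<le> b" using ex_upper_cover[OF ab] .
    then have "nb a b c"
      unfolding nb_def using interval_adj_avoiding_rtrancl[of c b a] by (auto simp: less_le_not_le)
    then have "E a b = - \<sigma> (a, c)" using E[of a b c] ab c by (auto simp: edge_val_def)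
    then show ?thesis using const_on_chains_le(1)[OF chains] c by simp
  qed
  have down: "E b a = - \<sigma> (a, b)" if ab: "a < b" for a b
  proof -
    obtain c where c: "adjacent b c" "c < b" "a \<le> c" using ex_lower_cover[OF ab] .
    then have "nb b a c"
      unfolding nb_def using interval_adj_avoiding_rtrancl[of a c b] sym[of b]
      by (auto simp: less_le_not_le dest: symD)
    then have "E b a = - \<sigma> (c, b)" using E[of b a c] ab c by (auto simp: edge_val_def)
    then show ?thesis using const_on_chains_le(2)[OF chains] c by simp
  qed
  \<comment> \<open>If \<open>x\<close> lies between \<open>a\<close> and \<open>b\<close>, deleting
    it may separate them, but then \<sigma> agrees on \<open>(a, x)\<close> and
    \<open>(x, b)\<close> by the chain condition. Otherwise both are reached through the same
    neighbour of \<open>x\<close>.\<close>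
  have off: "E x a = E x b" if ab: "a < b" "a \<noteq> x" "b \<noteq> x" for x a b
  proof (cases "x \<in> {a..b}")
    case True
    then have "a < x" "x < b" using ab by (auto simp: order.order_iff_strict)
    then show ?thesis using up[of x b] down[of a x] const_on_chains_triple[OF chains] by simp
  next
    case False
    obtain y where y: "nb x a y" using ex ab by blast
    then have "nb x b y"
      using interval_adj_avoiding_rtrancl[of a b x] False ab unfolding nb_def
      by (auto intro: rtrancl_trans)
    then show ?thesis using E y ab by metis
  qed
  have self: "E x x = 0" for x by (simp add: E_def)
  \<comment> \<open>Subtracting a constant for each \<open>x\<close> normalises at \<open>u0\<close>
    and leaves all differences unchanged.\<close>
  have "potential \<sigma> (\<lambda>x u. E x u - E x u0)"
    unfolding potential_def
  proof (intro allI impI)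
    fix x u v :: 'x
    assume "u < v"
    then have "u \<noteq> v" by simp
    then show "E x u - E x u0 - (E x v - E x u0) = (of_bool (u = x) - of_bool (v = x)) * \<sigma> (u, v)"
      using up[OF \<open>u < v\<close>] down[OF \<open>u < v\<close>] off[OF \<open>u < v\<close>, of x] self
      by (cases "u = x"; cases "v = x") auto
  qed
  then show ?thesis using that by simp
qed


section \<open>Brackets in the incidence algebra\<close>

lemma coef_diff [simp]: "coef (f - g) x y = coef f x y - coef g x y"
  by transfer simp

lemma coef_uminus [simp]: "coef (- f) x y = - coef f x y"
  by transfer simp

lemma coef_mult_e: "x \<le> y \<Longrightarrow> coef (f * e x y) u v = (if v = y then coef f u x else 0)"
proof -
  assume "x \<le> y"
  then have "coef (f * e x y) u v = (\<Sum>z\<in>UNIV. if z = x then (if v = y then coef f u x else 0) else 0)"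
    unfolding coef_mult coef_e by (intro sum.cong) auto
  then show ?thesis by simp
qed

lemma coef_e_mult: "x \<le> y \<Longrightarrow> coef (e x y * f) u v = (if u = x then coef f y v else 0)"
proof -
  assume "x \<le> y"
  then have "coef (e x y * f) u v = (\<Sum>z\<in>UNIV. if z = y then (if u = x then coef f y v else 0) else 0)"
    unfolding coef_mult coef_e by (intro sum.cong) auto
  then show ?thesis by simp
qed

lemma coef_bracket_e:
  "x \<le> y \<Longrightarrow> coef (inc_bracket f (e x y)) u v =
    (if v = y then coef f u x else 0) - (if u = x then coef f y v else 0)"
  by (simp add: inc_bracket_def coef_mult_e coef_e_mult)

lemma coef_e_bracket:
  "x \<le> y \<Longrightarrow> coef (inc_bracket (e x y) f) u v =
    (if u = x then coef f y v else 0) - (if v = y then coef f u x else 0)"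
  by (simp add: inc_bracket_def coef_mult_e coef_e_mult)

text \<open>The eigenvalue of \<open>e x x\<close> on \<open>e u v\<close> is the factor occurring
  in \<open>potential\<close>.\<close>

lemma bracket_e_e:
  "u < v \<Longrightarrow> inc_bracket (e x x) (e u v) = inc_scale (of_bool (u = x) - of_bool (v = x)) (e u v)"
  by (rule inc_eqI) (auto simp: coef_e_bracket coef_e)

lemma bracket_e_e_diag: "inc_bracket (e x x) (e y y) = 0"
  by (rule inc_eqI) (auto simp: coef_e_bracket coef_e)

text \<open>Only \<open>z = x\<close> contributes to the entry at \<open>(x, x)\<close> of a
  product, and scalars commute.\<close>

lemma coef_bracket_diag [simp]: "coef (inc_bracket f g) x x = 0"
proof -
  have "coef f x z * coef g z x = coef g x z * coef f z x" for z
  proof (cases "z = x")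
    case False
    then have "\<not> x \<le> z \<or> \<not> z \<le> x" by (metis order.antisym)
    then show ?thesis by (metis coef_eq_0 mult_zero_left mult_zero_right)
  qed simp
  then show ?thesis by (simp add: inc_bracket_def coef_mult)
qed

lemma linear_inc_eqI:
  fixes \<phi> \<psi> :: "('x::{finite,order}, 'k::field) inc \<Rightarrow> ('x, 'k) inc"
  assumes "Vector_Spaces.linear inc_scale inc_scale \<phi>" "Vector_Spaces.linear inc_scale inc_scale \<psi>"
    and basis: "\<And>x y. x \<le> y \<Longrightarrow> \<phi> (e x y) = \<psi> (e x y)"
  shows "\<phi> = \<psi>"
proof
  fix f
  interpret phi: Vector_Spaces.linear inc_scale inc_scale \<phi> by fact
  interpret psi: Vector_Spaces.linear inc_scale inc_scale \<psi> by fact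
  have "\<phi> (e x y) = \<psi> (e x y)" for x y
  proof (cases "x \<le> y")
    case False
    then have "e x y = (0 :: ('x, 'k) inc)" by (intro inc_eqI) (auto simp: coef_e)
    then show ?thesis by (simp add: phi.zero psi.zero)
  qed (rule basis)
  then show "\<phi> f = \<psi> f"
    by (subst (1 2) inc_expand)
      (simp add: phi.sum psi.sum phi.scale psi.scale del: coef_sum)
qed

text \<open>Brackets have zero diagonal; conversely, for \<open>x < y\<close> the element
  \<open>e x y\<close> is the bracket of \<open>e x x\<close> with itself.\<close>

lemma mem_derived_iff: "f \<in> inc.derived \<longleftrightarrow> (\<forall>x. coef f x x = 0)"
proof
  assume "f \<in> inc.derived"
  then show "\<forall>x. coef f x x = 0"
    unfolding inc.derived_def
  proof (induction rule: inc.span_induct)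
    case base
    show ?case by (auto simp: inc.subspace_def)
  qed auto
next
  assume f: "\<forall>x. coef f x x = 0"
  have "inc_scale (coef f x y) (e x y) \<in> inc.derived" for x y
  proof (cases "x < y")
    case True
    have "inc_bracket (e x x) (e x y) = (e x y :: ('a, 'b) inc)"
      using True by (auto simp: bracket_e_e)
    then have "e x y \<in> (inc.derived :: ('a, 'b) inc set)"
      unfolding inc.derived_def by (metis (mono_tags, lifting) inc.span_base mem_Collect_eq)
    then show ?thesis unfolding inc.derived_def by (rule inc.span_scale)
  next
    case False
    then have "coef f x y = 0" using f coef_eq_0[of x y f] by (cases "x = y") auto
    then show ?thesis unfolding inc.derived_def by (simp add: inc.span_zero)
  qed
  then show "f \<in> inc.derived"
    by (subst inc_expand) (auto simp: inc.derived_def intro!: inc.span_sum)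
qed

lemma mem_diag_iff: "f \<in> diag \<longleftrightarrow> (\<forall>x y. x \<noteq> y \<longrightarrow> coef f x y = 0)"
proof
  assume "f \<in> diag"
  then show "\<forall>x y. x \<noteq> y \<longrightarrow> coef f x y = 0"
    unfolding diag_def
  proof (induction rule: inc.span_induct)
    case base
    show ?case by (auto simp: inc.subspace_def)
  qed (auto simp: coef_e)
next
  assume f: "\<forall>x y. x \<noteq> y \<longrightarrow> coef f x y = 0"
  have "inc_scale (coef f x y) (e x y) \<in> diag" for x y
    using f unfolding diag_def
    by (cases "x = y") (auto intro: inc.span_scale inc.span_base inc.span_zero)
  then show "f \<in> diag"
    by (subst inc_expand) (auto simp: diag_def intro!: inc.span_sum)
qed


section \<open>The components of a half-derivation\<close>

lemma half_derivation_linear: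
  "inc.half_derivation \<phi> \<Longrightarrow> Vector_Spaces.linear inc_scale inc_scale \<phi>"
  by (simp add: inc.half_derivation_def)

text \<open>Clearing the factor 1/2 is legitimate in characteristic zero and leaves linear equations
  between coefficients.\<close>

lemma half_derivation_coef:
  fixes \<phi> :: "('x::{finite,order}, 'k::field_char_0) inc \<Rightarrow> ('x, 'k) inc"
  assumes "inc.half_derivation \<phi>"
  shows "2 * coef (\<phi> (inc_bracket a b)) u v =
    coef (inc_bracket (\<phi> a) b) u v + coef (inc_bracket a (\<phi> b)) u v"
  using assms by (simp add: inc.half_derivation_def)

lemma half_derivationI:
  fixes \<phi> :: "('x::{finite,order}, 'k::field_char_0) inc \<Rightarrow> ('x, 'k) inc"
  assumes "Vector_Spaces.linear inc_scale inc_scale \<phi>"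
    and "\<And>a b u v. 2 * coef (\<phi> (inc_bracket a b)) u v =
      coef (inc_bracket (\<phi> a) b) u v + coef (inc_bracket a (\<phi> b)) u v"
  shows "inc.half_derivation \<phi>"
  using assms by (auto simp: inc.half_derivation_def field_simps intro!: inc_eqI)

lemma half_derivation_diff:
  fixes \<phi> \<psi> :: "('x::{finite,order}, 'k::field_char_0) inc \<Rightarrow> ('x, 'k) inc"
  assumes "inc.half_derivation \<phi>" "inc.half_derivation \<psi>"
  shows "inc.half_derivation (\<lambda>a. \<phi> a - \<psi> a)"
proof (rule half_derivationI)
  interpret phi: Vector_Spaces.linear inc_scale inc_scale \<phi>
    using assms(1) by (rule half_derivation_linear)
  interpret psi: Vector_Spaces.linear inc_scale inc_scale \<psi>
    using assms(2) by (rule half_derivation_linear)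
  show "Vector_Spaces.linear inc_scale inc_scale (\<lambda>a. \<phi> a - \<psi> a)"
    by unfold_locales (simp_all add: phi.add psi.add phi.scale psi.scale inc_scale_diff)
  show "2 * coef (\<phi> (inc_bracket a b) - \<psi> (inc_bracket a b)) u v =
      coef (inc_bracket (\<phi> a - \<psi> a) b) u v + coef (inc_bracket a (\<phi> b - \<psi> b)) u v" for a b u v
  proof -
    have "inc_bracket (\<phi> a - \<psi> a) b = inc_bracket (\<phi> a) b - inc_bracket (\<psi> a) b"
      "inc_bracket a (\<phi> b - \<psi> b) = inc_bracket a (\<phi> b) - inc_bracket a (\<psi> b)"
      by (simp_all add: inc_bracket_def algebra_simps)
    then show ?thesis
      using half_derivation_coef[OF assms(1), of a b u v] half_derivation_coef[OF assms(2), of a b u v]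
      by (simp add: right_diff_distrib)
  qed
qed

text \<open>By the Leibniz rule both sides are multiples of \<open>[c, [a, b]]\<close>, which
  vanishes because \<open>[a, b]\<close> lies in the derived algebra.\<close>

lemma half_derivation_ad:
  fixes c :: "('x::{finite,order}, 'k::field_char_0) inc"
  assumes "c \<in> inc.center_of inc.derived"
  shows "inc.half_derivation (inc.ad c)"
proof (rule half_derivationI)
  show "Vector_Spaces.linear inc_scale inc_scale (inc.ad c)"
    by unfold_locales (simp_all add: inc.ad_def inc.bracket_add_right inc.bracket_scale_right)
  fix a b u v
  have "inc_bracket c (inc_bracket a b) = 0"
    using assms by (auto simp: inc.center_of_def mem_derived_iff)
  moreover have "inc_bracket (inc_bracket c a) b + inc_bracket a (inc_bracket c b) =
      inc_bracket c (inc_bracket a b)"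
    by (simp add: inc_bracket_def algebra_simps)
  ultimately show "2 * coef (inc.ad c (inc_bracket a b)) u v =
      coef (inc_bracket (inc.ad c a) b) u v + coef (inc_bracket a (inc.ad c b)) u v"
    by (metis coef_add coef_zero inc.ad_def mult_zero_right)
qed

lemma phi_kappa_linear: "Vector_Spaces.linear inc_scale inc_scale (phi_kappa \<kappa>)"
  and phi_kappa_e_diag: "phi_kappa \<kappa> (e x x) = inc_scale (\<kappa> x) 1"
  and phi_kappa_e: "x < y \<Longrightarrow> phi_kappa \<kappa> (e x y) = 0"
  using phi_kappa_unique[of "phi_kappa \<kappa>" \<kappa>] by auto

text \<open>Both sides vanish: the values are multiples of the identity, hence central, and brackets
  have zero diagonal.\<close>

lemma half_derivation_phi_kappa:
  fixes \<kappa> :: "'x::{finite,order} \<Rightarrow> 'k::field_char_0"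
  shows "inc.half_derivation (phi_kappa \<kappa>)"
proof (rule half_derivationI[OF phi_kappa_linear])
  fix a b :: "('x, 'k) inc" and u v
  have "inc_bracket (phi_kappa \<kappa> a) b = 0" "inc_bracket a (phi_kappa \<kappa> b) = 0"
    by (simp_all add: phi_kappa_def inc_bracket_def inc_scale_mult_left inc_scale_mult_right)
  moreover have "phi_kappa \<kappa> (inc_bracket a b) = 0"
    by (simp add: phi_kappa_def)
  ultimately show "2 * coef (phi_kappa \<kappa> (inc_bracket a b)) u v =
      coef (inc_bracket (phi_kappa \<kappa> a) b) u v + coef (inc_bracket a (phi_kappa \<kappa> b)) u v"
    by simp
qed

text \<open>Compare coefficients at \<open>(u, v)\<close> for \<open>[e x x, e u v]\<close>. With
  \<open>t\<close> the eigenvalue, the left side is \<open>2 * t * \<sigma> (u, v)\<close>; the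
  right side is the difference of diagonal entries plus \<open>t * \<sigma> (u, v)\<close>.\<close>

lemma half_derivation_potential:
  fixes \<phi> :: "('x::{finite,order}, 'k::field_char_0) inc \<Rightarrow> ('x, 'k) inc"
  assumes hd: "inc.half_derivation \<phi>"
    and \<sigma>: "\<And>u v. u < v \<Longrightarrow> \<sigma> (u, v) = coef (\<phi> (e u v)) u v"
  shows "potential \<sigma> (\<lambda>x u. coef (\<phi> (e x x)) u u)"
  unfolding potential_def
proof (intro allI impI)
  fix x u v :: 'x
  assume uv: "u < v"
  interpret phi: Vector_Spaces.linear inc_scale inc_scale \<phi>
    using hd by (rule half_derivation_linear)
  show "coef (\<phi> (e x x)) u u - coef (\<phi> (e x x)) v v = (of_bool (u = x) - of_bool (v = x)) * \<sigma> (u, v)"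
    using half_derivation_coef[OF hd, of "e x x" "e u v" u v] uv
    by (cases "u = x"; cases "v = x")
      (simp_all add: bracket_e_e phi.scale phi.zero phi.neg coef_bracket_e coef_e_bracket \<sigma> algebra_simps)
qed

section \<open>Coefficients of the images of basis elements\<close>

context
  fixes \<phi> :: "('x::{finite,order}, 'k::field_char_0) inc \<Rightarrow> ('x, 'k) inc"
  assumes hd: "inc.half_derivation \<phi>"
begin

interpretation phi: Vector_Spaces.linear inc_scale inc_scale \<phi>
  using hd by (rule half_derivation_linear)

lemma half_derivation_e_diag_bracket:
  "(if v = y then coef (\<phi> (e x x)) u y else 0) - (if u = y then coef (\<phi> (e x x)) y v else 0) +
    ((if u = x then coef (\<phi> (e y y)) x v else 0) - (if v = x then coef (\<phi> (e y y)) u x else 0)) = 0"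
  using half_derivation_coef[OF hd, of "e x x" "e y y" u v]
  by (simp add: bracket_e_e_diag phi.zero coef_bracket_e coef_e_bracket)

lemma half_derivation_e_diag_off:
  assumes "u \<noteq> v" "u \<noteq> x" "v \<noteq> x"
  shows "coef (\<phi> (e x x)) u v = 0"
  using half_derivation_e_diag_bracket[of v v x u] assms by simp

text \<open>This sign relation allows one entry of \<open>c\<close> to account for the off-diagonal
  parts at both ends of a pair.\<close>

lemma half_derivation_e_diag_antisym:
  assumes "x \<noteq> y"
  shows "coef (\<phi> (e x x)) x y = - coef (\<phi> (e y y)) x y"
  using half_derivation_e_diag_bracket[of y y x x] assms by (simp add: eq_neg_iff_add_eq_0)

text \<open>Since \<open>e x y = [e x x, e x y]\<close>, the image of \<open>e x y\<close> occurs on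
  both sides and can be solved for.\<close>

lemma half_derivation_e_source:
  assumes "x < y"
  shows "2 * coef (\<phi> (e x y)) u v =
    (if v = y then coef (\<phi> (e x x)) u x else 0) - (if u = x then coef (\<phi> (e x x)) y v else 0) +
    ((if u = x then coef (\<phi> (e x y)) x v else 0) - (if v = x then coef (\<phi> (e x y)) u x else 0))"
proof -
  have "inc_bracket (e x x) (e x y) = (e x y :: ('x, 'k) inc)"
    using assms by (auto simp: bracket_e_e)
  then show ?thesis
    using half_derivation_coef[OF hd, of "e x x" "e x y" u v] assms
    by (simp add: coef_bracket_e coef_e_bracket)
qed

lemma half_derivation_e_target:
  assumes "x < y"
  shows "2 * coef (\<phi> (e x y)) u v =
    (if u = x then coef (\<phi> (e y y)) y v else 0) - (if v = y then coef (\<phi> (e y y)) u x else 0) +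
    ((if v = y then coef (\<phi> (e x y)) u y else 0) - (if u = y then coef (\<phi> (e x y)) y v else 0))"
proof -
  have "inc_bracket (e x y) (e y y) = (e x y :: ('x, 'k) inc)"
    using assms by (intro inc_eqI) (auto simp: coef_bracket_e coef_e)
  then show ?thesis
    using half_derivation_coef[OF hd, of "e x y" "e y y" u v] assms
    by (simp add: coef_bracket_e coef_e_bracket)
qed

lemma half_derivation_e:
  assumes xy: "x < y"
  shows "\<phi> (e x y) = inc_scale (coef (\<phi> (e x y)) x y) (e x y)"
proof (rule inc_eqI)
  fix u v
  have ne: "x \<noteq> y" "y \<noteq> x" using xy by auto
  have z: "coef f y x = 0" for f :: "('x, 'k) inc" using xy by (intro coef_eq_0) auto
  have "coef (\<phi> (e x y)) u v = 0" if uv: "\<not> (u = x \<and> v = y)"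
  proof -
    \<comment> \<open>Row \<open>x\<close> is treated by the source relation, column
      \<open>y\<close> by the target relation, and what lies outside both by the source relation
      again.\<close>
    consider "u = x" "v = x" | "u = x" "v \<noteq> x" "v \<noteq> y" | "u = y" "v = y" | "u \<noteq> x" "u \<noteq> y" "v = y"
      | "u \<noteq> x" "v \<noteq> y"
      using uv by blast
    then show ?thesis
    proof cases
      case 1
      then show ?thesis using half_derivation_e_source[OF xy, of u v] ne z by auto
    next
      case 2
      then show ?thesis
        using half_derivation_e_source[OF xy, of u v] half_derivation_e_diag_off[of y v x] ne by auto
    next
      case 3
      then show ?thesis using half_derivation_e_target[OF xy, of u v] ne z by auto
    next
      case 4
      then show ?thesis
        using half_derivation_e_target[OF xy, of u v] half_derivation_e_diag_off[of u x y] ne by auto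
    next
      \<comment> \<open>For \<open>v = x\<close> the relation says that twice the entry is its
        negative, so 3 has to be invertible.\<close>
      case 5
      then show ?thesis
        using half_derivation_e_source[OF xy, of u v] ne by (cases "v = x") (auto simp: algebra_simps)
    qed
  qed
  then show "coef (\<phi> (e x y)) u v = coef (inc_scale (coef (\<phi> (e x y)) x y) (e x y)) u v"
    using xy by (auto simp: coef_e)
qed

text \<open>The entries at \<open>(x, z)\<close> of the images of \<open>e y z\<close> and
  \<open>e x y\<close> are zero, and twice these entries are the two coefficients. Hence
  \<open>c\<close> will be supported on pairs of a minimal and a maximal element.\<close>

lemma half_derivation_central_part:
  assumes "x < y" "y < z"
  shows "coef (\<phi> (e y y)) x y = 0" "coef (\<phi> (e y y)) y z = 0"
proof -
  have "coef (\<phi> (e y z)) x z = 0" "coef (\<phi> (e x y)) x z = 0"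
    using half_derivation_e[of y z] half_derivation_e[of x y] assms
    by (metis coef_e coef_scale less_irrefl mult_zero_right)+
  moreover have "x \<noteq> y" "y \<noteq> x" "y \<noteq> z" "z \<noteq> y" using assms by auto
  ultimately show "coef (\<phi> (e y y)) x y = 0" "coef (\<phi> (e y y)) y z = 0"
    using half_derivation_e_source[of y z x z] half_derivation_e_target[of x y x z] assms by auto
qed

end


section \<open>The half-derivation attached to a potential\<close>

text \<open>The predicate inside the definite description of \<open>phi_sigma\<close>, named so that
  its existence and uniqueness can be stated.\<close>

definition sigma_spec ::
  "'x::{finite,order} \<Rightarrow> ('x \<times> 'x \<Rightarrow> 'k::field) \<Rightarrow> (('x, 'k) inc \<Rightarrow> ('x, 'k) inc) \<Rightarrow> bool" where
  "sigma_spec u0 \<sigma> \<phi> \<longleftrightarrow> inc.half_derivation \<phi> \<and> \<phi> ` diag \<subseteq> diag \<and>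
    (\<forall>x y. x < y \<longrightarrow> \<phi> (e x y) = inc_scale (\<sigma> (x, y)) (e x y)) \<and>
    (\<forall>x. coef (\<phi> (e x x)) u0 u0 = 0)"

lemma e_diag_mem_diag [simp]: "e x x \<in> diag"
  by (auto simp: mem_diag_iff coef_e)

text \<open>The diagonals of both images of \<open>e x x\<close> are potentials for the same
  \<sigma>, so their difference is constant by connectedness, and it is zero at
  \<open>u0\<close>.\<close>

lemma sigma_spec_unique:
  fixes \<phi> \<psi> :: "('x::{finite,order}, 'k::field_char_0) inc \<Rightarrow> ('x, 'k) inc"
  assumes conn: "connected_poset TYPE('x)" and "sigma_spec u0 \<sigma> \<phi>" "sigma_spec u0 \<sigma> \<psi>"
  shows "\<phi> = \<psi>"
proof (rule linear_inc_eqI)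
  show "Vector_Spaces.linear inc_scale inc_scale \<phi>" "Vector_Spaces.linear inc_scale inc_scale \<psi>"
    using assms half_derivation_linear by (auto simp: sigma_spec_def)
  have pot: "potential \<sigma> (\<lambda>x u. coef (\<chi> (e x x)) u u)" if "sigma_spec u0 \<sigma> \<chi>"
    for \<chi> :: "('x, 'k) inc \<Rightarrow> ('x, 'k) inc"
    using that by (intro half_derivation_potential) (auto simp: sigma_spec_def coef_e)
  have diag: "\<phi> (e x x) = \<psi> (e x x)" for x
  proof (rule inc_eqI)
    fix u v
    show "coef (\<phi> (e x x)) u v = coef (\<psi> (e x x)) u v"
    proof (cases "u = v")
      case True
      have "coef (\<phi> (e x x)) u u - coef (\<psi> (e x x)) u u = coef (\<phi> (e x x)) u0 u0 - coef (\<psi> (e x x)) u0 u0"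
      proof (rule connected_poset_constant[OF conn])
        fix u v :: 'x
        assume "u < v"
        then have "coef (\<phi> (e x x)) u u - coef (\<phi> (e x x)) v v = coef (\<psi> (e x x)) u u - coef (\<psi> (e x x)) v v"
          using pot[OF assms(2)] pot[OF assms(3)] by (simp add: potential_def)
        then show "coef (\<phi> (e x x)) u u - coef (\<psi> (e x x)) u u =
            coef (\<phi> (e x x)) v v - coef (\<psi> (e x x)) v v"
          by (simp add: algebra_simps)
      qed
      then show ?thesis using assms True by (simp add: sigma_spec_def)
    next
      case False
      have "\<phi> (e x x) \<in> diag" "\<psi> (e x x) \<in> diag"
        using assms by (auto simp: sigma_spec_def)
      then show ?thesis using False by (simp add: mem_diag_iff)
    qed
  qed
  show "\<phi> (e x y) = \<psi> (e x y)" if "x \<le> y" for x y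
    using that assms diag by (cases "x = y") (auto simp: sigma_spec_def)
qed

lemma phi_sigma_eqI:
  fixes \<phi> :: "('x::{finite,order}, 'k::field_char_0) inc \<Rightarrow> ('x, 'k) inc"
  assumes "connected_poset TYPE('x)" "sigma_spec u0 \<sigma> \<phi>"
  shows "phi_sigma u0 \<sigma> = \<phi>"
  unfolding phi_sigma_def sigma_spec_def[symmetric]
  using assms sigma_spec_unique by blast

text \<open>The explicit witness for the definite description of \<open>phi_sigma\<close>;
  \<open>D x\<close> is the diagonal of the image of \<open>e x x\<close>.\<close>

lift_definition pot_map ::
  "('x::{finite,order} \<times> 'x \<Rightarrow> 'k::field) \<Rightarrow> ('x \<Rightarrow> 'x \<Rightarrow> 'k) \<Rightarrow> ('x, 'k) inc \<Rightarrow> ('x, 'k) inc"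
  is "\<lambda>\<sigma> D f u v. if u = v then \<Sum>x\<in>UNIV. f x x * D x u else \<sigma> (u, v) * f u v"
  by auto

lemma coef_pot_map:
  "coef (pot_map \<sigma> D f) u v =
    (if u = v then \<Sum>x\<in>UNIV. coef f x x * D x u else \<sigma> (u, v) * coef f u v)"
  by transfer simp

text \<open>The correction \<open>r\<close> contributes \<open>(r u u - r v v) * coef b u v\<close>
  to the bracket, and the potential property makes the two diagonal values equal.\<close>

lemma pot_map_bracket:
  fixes \<sigma> :: "'x::{finite,order} \<times> 'x \<Rightarrow> 'k::field"
  assumes chains: "const_on_chains \<sigma>" and pot: "potential \<sigma> D" and uv: "u < v"
  shows "coef (inc_bracket (pot_map \<sigma> D a) b) u v = \<sigma> (u, v) * coef (inc_bracket a b) u v"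
proof -
  define s where "s = \<sigma> (u, v)"
  text \<open>Inside \<open>[u, v]\<close>, the map differs from multiplication by \<open>s\<close> only on the diagonal.\<close>
  define r where "r = (\<lambda>p q. coef (pot_map \<sigma> D a) p q - s * coef a p q)"
  have r_left: "r u z * coef b z v = (if z = u then r u u * coef b u v else 0)" for z
  proof -
    have "\<sigma> (u, z) = s" if "u < z" "z \<le> v"
      using const_on_chains_le(1)[OF chains that] by (simp add: s_def)
    then show ?thesis
      by (cases "z \<le> v"; cases "u \<le> z") (auto simp: r_def coef_pot_map coef_eq_0)
  qed
  have r_right: "coef b u z * r z v = (if z = v then coef b u v * r v v else 0)" for z
  proof -
    have "\<sigma> (z, v) = s" if "u \<le> z" "z < v"
      using const_on_chains_le(2)[OF chains that] by (simp add: s_def)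
    then show ?thesis
      by (cases "z \<le> v"; cases "u \<le> z") (auto simp: r_def coef_pot_map coef_eq_0)
  qed
  \<comment> \<open>\<open>D x u - D x v\<close> is nonzero at most for \<open>x = u\<close> and
    \<open>x = v\<close>, where it is \<open>s\<close> and \<open>- s\<close>.\<close>
  have "r u u = r v v"
  proof -
    have "coef (pot_map \<sigma> D a) u u - coef (pot_map \<sigma> D a) v v = (\<Sum>x\<in>UNIV. coef a x x * (D x u - D x v))"
      by (simp add: coef_pot_map sum_subtractf algebra_simps)
    also have "\<dots> = (\<Sum>x\<in>UNIV. (if x = u then s * coef a u u else 0) - (if x = v then s * coef a v v else 0))"
      using pot uv by (intro sum.cong) (auto simp: potential_def s_def)
    also have "\<dots> = s * coef a u u - s * coef a v v"
      by (simp add: sum_subtractf)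
    finally show ?thesis by (simp add: r_def algebra_simps)
  qed
  have "coef (inc_bracket (pot_map \<sigma> D a) b) u v - s * coef (inc_bracket a b) u v =
      (\<Sum>z\<in>UNIV. r u z * coef b z v) - (\<Sum>z\<in>UNIV. coef b u z * r z v)"
    by (simp add: inc_bracket_def coef_mult r_def sum_distrib_left algebra_simps
        sum_subtractf sum.distrib)
  also have "\<dots> = 0"
    by (subst sum.cong[OF refl r_left], subst sum.cong[OF refl r_right]) (simp add: \<open>r u u = r v v\<close>)
  finally show ?thesis by (simp add: s_def)
qed

lemma sigma_spec_pot_map:
  fixes \<sigma> :: "'x::{finite,order} \<times> 'x \<Rightarrow> 'k::field_char_0"
  assumes chains: "const_on_chains \<sigma>" and pot: "potential \<sigma> D" and u0: "\<And>x. D x u0 = 0"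
  shows "sigma_spec u0 \<sigma> (pot_map \<sigma> D)"
  unfolding sigma_spec_def
proof (intro conjI allI impI)
  show "inc.half_derivation (pot_map \<sigma> D)"
  proof (rule half_derivationI)
    show "Vector_Spaces.linear inc_scale inc_scale (pot_map \<sigma> D)"
      by unfold_locales
        (auto intro!: inc_eqI simp: coef_pot_map algebra_simps sum.distrib sum_distrib_left)
    fix a b :: "('x, 'k) inc" and u v
    \<comment> \<open>Antisymmetry lets \<open>pot_map_bracket\<close> evaluate the second summand
      too; each summand equals the value on the bracket, which produces the factor 2.\<close>
    have swap: "inc_bracket a (pot_map \<sigma> D b) = 0 - inc_bracket (pot_map \<sigma> D b) a"
      "inc_bracket a b = 0 - inc_bracket b a"
      by (simp_all add: inc_bracket_def)
    show "2 * coef (pot_map \<sigma> D (inc_bracket a b)) u v =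
        coef (inc_bracket (pot_map \<sigma> D a) b) u v + coef (inc_bracket a (pot_map \<sigma> D b)) u v"
    proof (cases "u < v")
      case True
      have "coef (inc_bracket a (pot_map \<sigma> D b)) u v = \<sigma> (u, v) * coef (inc_bracket a b) u v"
        unfolding swap using pot_map_bracket[OF chains pot True] by simp
      then show ?thesis
        using True pot_map_bracket[OF chains pot True] by (auto simp: coef_pot_map)
    next
      case False
      then show ?thesis by (cases "u = v") (auto simp: coef_pot_map coef_eq_0)
    qed
  qed
  show "pot_map \<sigma> D ` diag \<subseteq> diag"
    by (auto simp: mem_diag_iff coef_pot_map)
  show "pot_map \<sigma> D (e x y) = inc_scale (\<sigma> (x, y)) (e x y)" if "x < y" for x y
  proof (rule inc_eqI)
    fix u v
    have "coef (e x y) z z = (0::'k)" for z using that by (auto simp: coef_e)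
    then show "coef (pot_map \<sigma> D (e x y)) u v = coef (inc_scale (\<sigma> (x, y)) (e x y)) u v"
      by (auto simp: coef_pot_map coef_e)
  qed
  show "coef (pot_map \<sigma> D (e x x)) u0 u0 = 0" for x
    by (simp add: coef_pot_map u0)
qed

text \<open>The potential supplied by the two constancy conditions gives existence, so the definite
  description denotes.\<close>

lemma sigma_spec_phi_sigma:
  fixes \<sigma> :: "'x::{finite,order} \<times> 'x \<Rightarrow> 'k::field_char_0"
  assumes "connected_poset TYPE('x)" "const_on_chains \<sigma>" "const_on_cycles \<sigma>"
  shows "sigma_spec u0 \<sigma> (phi_sigma u0 \<sigma>)"
proof -
  obtain D where "potential \<sigma> D" "\<And>x. D x u0 = 0"
    using ex_potential[OF assms] by blast
  then have "sigma_spec u0 \<sigma> (pot_map \<sigma> D)"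
    using sigma_spec_pot_map assms(2) by blast
  then show ?thesis using phi_sigma_eqI[OF assms(1)] by metis
qed


section \<open>The decomposition\<close>

lemma center_bracket_e:
  fixes c :: "('x::{finite,order}, 'k::field) inc"
  assumes "c \<in> inc.center_of inc.derived" "x < y"
  shows "inc_bracket c (e x y) = 0"
  using assms by (auto simp: inc.center_of_def mem_derived_iff coef_e)

text \<open>After subtracting \<open>inc.ad c\<close> and \<open>phi_kappa \<kappa>\<close>, the
  remainder satisfies \<open>sigma_spec\<close>, and uniqueness identifies it with
  \<open>phi_sigma\<close>.\<close>

lemma half_derivation_decomposition:
  fixes \<phi> :: "('x::{finite,order}, 'k::field_char_0) inc \<Rightarrow> ('x, 'k) inc"
  assumes conn: "connected_poset TYPE('x)" and hd: "inc.half_derivation \<phi>"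
  shows "\<exists>c \<sigma> \<kappa>. c \<in> inc.center_of inc.derived \<and> \<sigma> \<in> strict_pairs \<rightarrow>\<^sub>E UNIV \<and>
    const_on_chains \<sigma> \<and> const_on_cycles \<sigma> \<and>
    \<phi> = (\<lambda>a. inc.ad c a + phi_sigma u0 \<sigma> a + phi_kappa \<kappa> a)"
proof -
  \<comment> \<open>Chosen because \<open>[c, e y y]\<close> has the entry \<open>coef c x y\<close>
    at \<open>(x, y)\<close> for \<open>x < y\<close>.\<close>
  define c where "c = Abs_inc (\<lambda>x y. if x < y then coef (\<phi> (e y y)) x y else 0)"
  \<comment> \<open>Restriction fixes the value off \<open>strict_pairs\<close>, which uniqueness of
    \<sigma> as a total function requires.\<close>
  define \<sigma> where "\<sigma> = restrict (\<lambda>(x, y). coef (\<phi> (e x y)) x y) strict_pairs"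
  define \<kappa> where "\<kappa> = (\<lambda>x. coef (\<phi> (e x x)) u0 u0)"
  define \<psi> where "\<psi> = (\<lambda>a. \<phi> a - inc.ad c a - phi_kappa \<kappa> a)"
  have coef_c: "coef c x y = (if x < y then coef (\<phi> (e y y)) x y else 0)" for x y
    unfolding c_def by (subst Abs_inc_inverse) auto
  have c: "c \<in> inc.center_of inc.derived"
    unfolding inc.center_of_def mem_Collect_eq
  proof (intro conjI ballI)
    show "c \<in> inc.derived" by (simp add: mem_derived_iff coef_c)
    fix a :: "('x, 'k) inc"
    assume "a \<in> inc.derived"
    then have a: "\<forall>x. coef a x x = 0" by (simp add: mem_derived_iff)
    have nz: "coef a p q = 0" if "\<not> p < q" for p q
      using a that coef_eq_0[of p q a] by (cases "p = q") auto
    \<comment> \<open>The products vanish termwise: a nonzero term needs \<open>p < q\<close> and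
      \<open>q < r\<close>, where the entry of \<open>c\<close> is zero.\<close>
    have "coef c p q * coef a q r = 0" for p q r
      using half_derivation_central_part(1)[OF hd, of p q r] nz[of q r] by (auto simp: coef_c)
    moreover have "coef a p q * coef c q r = 0" for p q r
      using half_derivation_central_part(2)[OF hd, of p q r] nz[of p q]
        half_derivation_e_diag_antisym[OF hd, of q r]
      by (auto simp: coef_c)
    ultimately show "inc_bracket c a = 0"
      by (intro inc_eqI) (simp only: inc_bracket_def coef_diff coef_mult coef_zero sum.neutral_const diff_zero)
  qed
  have \<sigma>: "\<sigma> (u, v) = coef (\<phi> (e u v)) u v" if "u < v" for u v
    using that by (simp add: \<sigma>_def)
  have pot: "potential \<sigma> (\<lambda>x u. coef (\<phi> (e x x)) u u)"
    using hd \<sigma> by (rule half_derivation_potential)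
  have \<psi>: "inc.half_derivation \<psi>"
    unfolding \<psi>_def
    by (intro half_derivation_diff hd half_derivation_ad[OF c] half_derivation_phi_kappa)
  have "sigma_spec u0 \<sigma> \<psi>"
    unfolding sigma_spec_def
  proof (intro conjI allI impI)
    interpret psi: Vector_Spaces.linear inc_scale inc_scale \<psi>
      using \<psi> by (rule half_derivation_linear)
    show "inc.half_derivation \<psi>" by (rule \<psi>)
    have "\<psi> (e x x) \<in> diag" for x
      unfolding mem_diag_iff
    proof (intro allI impI)
      fix u v :: 'x
      assume uv: "u \<noteq> v"
      have *: "coef (\<psi> (e x x)) u v = coef (\<phi> (e x x)) u v -
          ((if v = x then coef c u x else 0) - (if u = x then coef c x v else 0))"
        using uv by (simp add: \<psi>_def inc.ad_def coef_bracket_e phi_kappa_e_diag coef_one)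
      show "coef (\<psi> (e x x)) u v = 0"
      proof (cases "u < v")
        case True
        then show ?thesis
          using * half_derivation_e_diag_off[OF hd, of u v x] half_derivation_e_diag_antisym[OF hd, of x v]
          by (auto simp: coef_c)
      next
        case False
        then show ?thesis using uv by (intro coef_eq_0) auto
      qed
    qed
    moreover have "inc.subspace {f. \<psi> f \<in> diag}"
      by (simp add: inc.subspace_def mem_diag_iff psi.zero psi.add psi.scale)
    ultimately have "inc.span (range (\<lambda>x. e x x)) \<subseteq> {f. \<psi> f \<in> diag}"
      by (intro inc.span_minimal) auto
    then show "\<psi> ` diag \<subseteq> diag" unfolding diag_def[symmetric] by blast
    show "\<psi> (e x y) = inc_scale (\<sigma> (x, y)) (e x y)" if "x < y" for x y
      using half_derivation_e[OF hd that] that center_bracket_e[OF c that]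
      by (simp add: \<psi>_def inc.ad_def phi_kappa_e \<sigma>)
    show "coef (\<psi> (e x x)) u0 u0 = 0" for x
      by (simp add: \<psi>_def inc.ad_def phi_kappa_e_diag coef_one \<kappa>_def)
  qed
  then have "phi_sigma u0 \<sigma> = \<psi>" by (rule phi_sigma_eqI[OF conn])
  then have "\<phi> = (\<lambda>a. inc.ad c a + phi_sigma u0 \<sigma> a + phi_kappa \<kappa> a)"
    by (simp add: \<psi>_def)
  moreover have "\<sigma> \<in> strict_pairs \<rightarrow>\<^sub>E UNIV" by (simp add: \<sigma>_def)
  ultimately show ?thesis
    using c potential_imp_const_on_chains[OF pot] potential_imp_const_on_cycles[OF pot] by blast
qed

text \<open>Each component is seen where the others vanish: \<open>phi_sigma\<close> keeps diagonals
  diagonal and is zero at \<open>u0\<close>, \<open>inc.ad c\<close> kills \<open>e x y\<close> for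
  \<open>x < y\<close> and has zero diagonal, and \<open>phi_kappa\<close> yields only multiples of
  the identity.\<close>

lemma decomposition_coef:
  fixes u0 :: "'x::{finite,order}" and \<sigma> :: "'x \<times> 'x \<Rightarrow> 'k::field_char_0"
  assumes conn: "connected_poset TYPE('x)"
    and c: "c \<in> inc.center_of inc.derived"
    and \<sigma>: "const_on_chains \<sigma>" "const_on_cycles \<sigma>"
    and \<phi>: "\<phi> = (\<lambda>a. inc.ad c a + phi_sigma u0 \<sigma> a + phi_kappa \<kappa> a)"
  shows "x < y \<Longrightarrow> coef c x y = coef (\<phi> (e y y)) x y"
    and "x < y \<Longrightarrow> \<sigma> (x, y) = coef (\<phi> (e x y)) x y"
    and "\<kappa> x = coef (\<phi> (e x x)) u0 u0"
proof -
  have spec: "sigma_spec u0 \<sigma> (phi_sigma u0 \<sigma>)" using sigma_spec_phi_sigma[OF conn \<sigma>] .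
  show "coef c x y = coef (\<phi> (e y y)) x y" if "x < y"
  proof -
    have "phi_sigma u0 \<sigma> (e y y) \<in> diag" using spec by (auto simp: sigma_spec_def)
    then have "coef (phi_sigma u0 \<sigma> (e y y)) x y = 0" using that by (simp add: mem_diag_iff)
    then show ?thesis
      using less_imp_neq[OF that]
      by (simp add: \<phi> inc.ad_def coef_bracket_e phi_kappa_e_diag coef_one)
  qed
  show "\<sigma> (x, y) = coef (\<phi> (e x y)) x y" if "x < y"
    using spec that less_imp_le[OF that] center_bracket_e[OF c that]
    by (simp add: \<phi> inc.ad_def phi_kappa_e sigma_spec_def coef_e)
  show "\<kappa> x = coef (\<phi> (e x x)) u0 u0"
    using spec by (simp add: \<phi> inc.ad_def phi_kappa_e_diag sigma_spec_def coef_one)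
qed

theorem theorem2p30:
  fixes u0 :: "'x::{finite,order}"
    and \<phi> :: "('x, 'k::field_char_0) inc \<Rightarrow> ('x, 'k) inc"
  assumes "connected_poset TYPE('x)"
    and "inc.half_derivation \<phi>"
  shows "\<exists>!(c, \<sigma>, \<kappa>).
    c \<in> inc.center_of (inc.derived :: ('x, 'k) inc set) \<and>
    \<sigma> \<in> strict_pairs \<rightarrow>\<^sub>E (UNIV :: 'k set) \<and> const_on_chains \<sigma> \<and> const_on_cycles \<sigma> \<and>
    \<phi> = (\<lambda>a. inc.ad c a + phi_sigma u0 \<sigma> a + phi_kappa \<kappa> a)"
proof -
  define P where "P = (\<lambda>(c :: ('x, 'k) inc, \<sigma>, \<kappa>).
    c \<in> inc.center_of (inc.derived :: ('x, 'k) inc set) \<and>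
    \<sigma> \<in> strict_pairs \<rightarrow>\<^sub>E (UNIV :: 'k set) \<and> const_on_chains \<sigma> \<and> const_on_cycles \<sigma> \<and>
    \<phi> = (\<lambda>a. inc.ad c a + phi_sigma u0 \<sigma> a + phi_kappa \<kappa> a))"
  have "\<exists>p. P p"
    using half_derivation_decomposition[OF assms, of u0] by (auto simp: P_def)
  moreover have "p = q" if "P p" "P q" for p q
  proof -
    obtain c \<sigma> \<kappa> c' \<sigma>' \<kappa>' where pq: "p = (c, \<sigma>, \<kappa>)" "q = (c', \<sigma>', \<kappa>')"
      by (metis prod_cases3)
    have c: "c \<in> inc.center_of inc.derived" and \<sigma>: "\<sigma> \<in> strict_pairs \<rightarrow>\<^sub>E UNIV"
      and "const_on_chains \<sigma>" "const_on_cycles \<sigma>"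
      and "\<phi> = (\<lambda>a. inc.ad c a + phi_sigma u0 \<sigma> a + phi_kappa \<kappa> a)"
      using that(1) unfolding pq P_def by auto
    note coefs = decomposition_coef[OF assms(1) this(1,3-5)]
    have c': "c' \<in> inc.center_of inc.derived" and \<sigma>': "\<sigma>' \<in> strict_pairs \<rightarrow>\<^sub>E UNIV"
      and "const_on_chains \<sigma>'" "const_on_cycles \<sigma>'"
      and "\<phi> = (\<lambda>a. inc.ad c' a + phi_sigma u0 \<sigma>' a + phi_kappa \<kappa>' a)"
      using that(2) unfolding pq P_def by auto
    note coefs' = decomposition_coef[OF assms(1) this(1,3-5)]
    have "c = c'"
    proof (rule inc_eqI)
      fix x y :: 'x
      \<comment> \<open>The diagonal entries are zero because the center lies in the derived
        algebra.\<close>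
      consider "x < y" | "x = y" | "\<not> x \<le> y" by (auto simp: order.order_iff_strict)
      then show "coef c x y = coef c' x y"
      proof cases
        case 1
        then show ?thesis using coefs(1) coefs'(1) by simp
      next
        case 2
        then show ?thesis using c c' by (simp add: inc.center_of_def mem_derived_iff)
      qed (simp add: coef_eq_0)
    qed
    \<comment> \<open>Both functions are \<open>undefined\<close> off \<open>strict_pairs\<close>,
      so agreement on strict pairs suffices.\<close>
    moreover have "\<sigma> = \<sigma>'"
      using \<sigma> \<sigma>' coefs(2) coefs'(2) by (intro PiE_ext[of \<sigma> strict_pairs]) auto
    moreover have "\<kappa> = \<kappa>'" using coefs(3) coefs'(3) by auto
    ultimately show ?thesis by (simp add: pq)
  qed
  ultimately have "\<exists>!p. P p" by blast
  then show ?thesis by (simp add: P_def)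
qed

end
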